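(* Let $m$ and $n$ be non-negative integers. Then $$ \sum_{k=1}^{m}\binom{n+k-2}{k-1}\binom{n-1}{k-1}\binom{m+n}{m-k} =\sum_{k=0}^m k\binom{m+n-k-1}{n-1}^2. $$ *)

theory Defs
  imports Complex_Main
begin

text \<open>
  Binomial coefficients with integer entries, real-valued because \<open>gchoose\<close> needs a
  field. For \<open>b \<ge> 0\<close> this is the usual \<open>a (a - 1) \<cdots> (a - b + 1) / b!\<close>;
  negative lower entries are given by the symmetry \<open>binom a b = binom a (a - b)\<close>, with
  value 0 if \<open>b < 0\<close> and \<open>b > a\<close>. For \<open>a \<ge> 0\<close> these are the ordinary values,
  which vanish unless \<open>0 \<le> b \<le> a\<close>. In the theorem negative entries occur only for
  \<open>n = 0\<close>, where the nonzero terms involve \<open>binom (-1) 0 = 1\<close> and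
  \<open>binom (-1) (-1) = 1\<close>.
\<close>

definition binom :: "int \<Rightarrow> int \<Rightarrow> real" where
  "binom a b = (if 0 \<le> b then real_of_int a gchoose nat b
                else if b \<le> a then real_of_int a gchoose nat (a - b)
                else 0)"

end

theory Submission
  imports Defs
begin

text \<open>
  For \<open>n = N + 1\<close> both sides, as functions of \<open>m\<close>, start with the values 0, 1 and have second
  difference \<open>((m + 1 + N) choose N)\<^sup>2\<close>. On the right this is the effect of convolving with
  \<open>k\<close>. On the left, once the last factor is written as \<open>(m + N + 1) choose (N + 2 + j)\<close> with
  \<open>j = k - 1\<close>, Pascal's rule applied twice lowers the entry below by 2, and the resulting sum is
  evaluated by trinomial revision and Vandermonde's identity.
\<close>

lemma binom_of_nat: "binom (int a) (int b) = real (a choose b)"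
  by (simp add: binom_def binomial_gbinomial)

lemma sum_choose_choose_eq:
  "(\<Sum>j\<le>N. (N choose j) * (m choose j)) = (m + N) choose N"
proof -
  have "(\<Sum>j\<le>N. (N choose j) * (m choose j)) = (\<Sum>j\<le>N. (m choose j) * (N choose (N - j)))"
    by (intro sum.cong) (auto simp: binomial_symmetric[symmetric])
  then show ?thesis
    by (simp add: vandermonde)
qed

text \<open>Trinomial revision replaces the two factors containing \<open>N + j\<close> by
  \<open>(m + N) choose N\<close> times \<open>m choose j\<close>. The first does not depend on
  \<open>j\<close> and leaves the sum; Vandermonde produces its second copy.\<close>

lemma sum_choose_eq_choose_squared:
  "(\<Sum>j\<le>N. ((N + j) choose j) * (N choose j) * ((m + N) choose (N + j))) = ((m + N) choose N)\<^sup>2"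
proof -
  have "((N + j) choose j) * ((m + N) choose (N + j)) = ((m + N) choose N) * (m choose j)" for j
  proof (cases "j \<le> m")
    case True
    then have "((m + N) choose (N + j)) * ((N + j) choose N) = ((m + N) choose N) * (m choose j)"
      using choose_mult[of N "N + j" "m + N"] by simp
    moreover have "(N + j) choose N = (N + j) choose j"
      using binomial_symmetric[of N "N + j"] by simp
    ultimately show ?thesis
      by (simp add: mult.commute)
  qed (simp add: binomial_eq_0)
  then have "(\<Sum>j\<le>N. ((N + j) choose j) * (N choose j) * ((m + N) choose (N + j)))
      = (\<Sum>j\<le>N. ((m + N) choose N) * ((N choose j) * (m choose j)))"
    by (intro sum.cong) (simp_all add: mult.assoc mult.left_commute[of "N choose _"])
  then show ?thesis
    by (simp only: sum_distrib_left[symmetric] sum_choose_choose_eq power2_eq_square)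
qed

text \<open>Additive form of a second difference in the upper entry, so that no truncated
  subtraction on \<open>nat\<close> arises.\<close>

lemma choose_second_difference:
  "(Suc (Suc a) choose Suc (Suc b)) + (a choose Suc (Suc b))
    = 2 * (Suc a choose Suc (Suc b)) + (a choose b)"
  by simp

text \<open>Convolving with the identity is summing twice, so one difference leaves the partial sums
  of \<open>f\<close> and a second one leaves \<open>f\<close> itself.\<close>

lemma convolution_id_Suc:
  fixes f :: "nat \<Rightarrow> nat"
  shows "(\<Sum>k\<le>Suc m. k * f (Suc m - k)) = (\<Sum>k\<le>m. k * f (m - k)) + (\<Sum>k\<le>m. f k)"
proof -
  have "(\<Sum>k\<le>Suc m. k * f (Suc m - k)) = (\<Sum>k\<le>m. Suc k * f (m - k))"
    by (simp only: sum.atMost_Suc_shift) simp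
  also have "\<dots> = (\<Sum>k\<le>m. k * f (m - k)) + (\<Sum>k\<le>m. f (m - k))"
    by (simp add: sum.distrib add.commute)
  also have "(\<Sum>k\<le>m. f (m - k)) = (\<Sum>k\<le>m. f k)"
    using sum.nat_diff_reindex[of f "Suc m"] by (simp add: lessThan_Suc_atMost)
  finally show ?thesis .
qed

text \<open>The range \<open>j \<le> N\<close> is independent of \<open>m\<close>, so on the left
  only the last factor changes in the two-step induction.\<close>

lemma sum_choose_eq_convolution:
  "(\<Sum>j\<le>N. ((N + j) choose j) * (N choose j) * ((m + N + 1) choose (N + 2 + j)))
    = (\<Sum>k\<le>m. k * ((m - k + N) choose N)\<^sup>2)"
  (is "?L m = ?R m")
proof (induction m rule: induct_nat_012)
  case 0
  show ?case
    by simp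
next
  case 1
  \<comment> \<open>The last factor is \<open>(N + 2) choose (N + 2 + j)\<close>, which vanishes for
    \<open>j > 0\<close>.\<close>
  have "?L (Suc 0) = (\<Sum>j\<le>N. if j = 0 then 1 else 0)"
    by (intro sum.cong) (auto simp: binomial_eq_0)
  then show ?case
    by simp
next
  case (ge2 m)
  have "((N + j) choose j) * (N choose j) * ((Suc (Suc m) + N + 1) choose (N + 2 + j))
      + ((N + j) choose j) * (N choose j) * ((m + N + 1) choose (N + 2 + j))
      = 2 * (((N + j) choose j) * (N choose j) * ((Suc m + N + 1) choose (N + 2 + j)))
      + ((N + j) choose j) * (N choose j) * ((Suc m + N) choose (N + j))" for j
    using arg_cong[OF choose_second_difference[of "Suc (m + N)" "N + j"],
        of "\<lambda>x. ((N + j) choose j) * (N choose j) * x"]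
    by (simp add: distrib_left mult_ac del: binomial_Suc_Suc)
  then have "?L (Suc (Suc m)) + ?L m = 2 * ?L (Suc m) + ((Suc m + N) choose N)\<^sup>2"
    unfolding sum_choose_eq_choose_squared[of N "Suc m", symmetric] sum_distrib_left
      sum.distrib[symmetric]
    by (intro sum.cong) auto
  moreover have "?R (Suc (Suc m)) + ?R m = 2 * ?R (Suc m) + ((Suc m + N) choose N)\<^sup>2"
    unfolding convolution_id_Suc[of "\<lambda>i. ((i + N) choose N)\<^sup>2"] by simp
  ultimately show ?case
    using ge2 by linarith
qed

text \<open>Negative entries occur only for \<open>n = 0\<close>. There the left side reduces to its
  term \<open>k = 1\<close> and the right side to \<open>k = m\<close>, and both equal
  \<open>m\<close>.\<close>

lemma theorem1p3_n_eq_0: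
  "(\<Sum>k=1..m. binom (int k - 2) (int k - 1) * binom (- 1) (int k - 1) * binom (int m) (int m - int k))
    = (\<Sum>k=0..m. real k * (binom (int m - int k - 1) (- 1))\<^sup>2)"
proof -
  have "binom (int k - 2) (int k - 1) * binom (- 1) (int k - 1) * binom (int m) (int m - int k)
      = (if k = 1 then real m else 0)" if k: "k \<in> {1..m}" for k
  proof (cases "k = 1")
    case True
    then have "int m - int k = int (m - 1)"
      using k by auto
    then have "binom (int m) (int m - int k) = m choose (m - 1)"
      by (simp only: binom_of_nat)
    then have "binom (int m) (int m - int k) = m"
      using k binomial_symmetric[of 1 m] by simp
    moreover have "binom (int k - 2) (int k - 1) = 1" "binom (- 1) (int k - 1) = 1"
      using True by (simp_all add: binom_def)
    ultimately show ?thesis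
      using True by simp
  next
    case False
    then have "int k - 2 = int (k - 2)" "int k - 1 = int (k - 1)"
      using k by auto
    then have "binom (int k - 2) (int k - 1) = real ((k - 2) choose (k - 1))"
      by (simp only: binom_of_nat)
    moreover have "k - 2 < k - 1"
      using False k unfolding atLeastAtMost_iff by linarith
    ultimately show ?thesis
      using False by (simp add: binomial_eq_0)
  qed
  then have "(\<Sum>k=1..m. binom (int k - 2) (int k - 1) * binom (- 1) (int k - 1)
      * binom (int m) (int m - int k)) = (\<Sum>k=1..m. if k = 1 then real m else 0)"
    by (intro sum.cong) auto
  moreover have "real k * (binom (int m - int k - 1) (- 1))\<^sup>2 = (if k = m then real m else 0)"
    if k: "k \<in> {0..m}" for k
  proof (cases "k = m")
    case False
    then obtain d where d: "m = Suc (k + d)"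
      using k less_imp_Suc_add[of k m] by auto
    \<comment> \<open>The symmetry clause of \<open>binom\<close> turns the lower entry -1 into
      \<open>d + 1\<close>, which exceeds the upper entry \<open>d\<close>.\<close>
    have "nat (int d + 1) = Suc d"
      by simp
    then have "binom (int m - int k - 1) (- 1) = d choose Suc d"
      using d by (simp add: binom_def binomial_gbinomial)
    then show ?thesis
      using False by (simp add: binomial_eq_0)
  qed (simp add: binom_def)
  then have "(\<Sum>k=0..m. real k * (binom (int m - int k - 1) (- 1))\<^sup>2)
      = (\<Sum>k=0..m. if k = m then real m else 0)"
    by (intro sum.cong) auto
  ultimately show ?thesis
    by (cases "m = 0") (simp_all add: Suc_le_eq)
qed

theorem theorem1p3:
  fixes m n :: nat
  shows "(\<Sum>k=1..m. binom (int n + int k - 2) (int k - 1) * binom (int n - 1) (int k - 1)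
                      * binom (int m + int n) (int m - int k))
       = (\<Sum>k=0..m. real k * (binom (int m + int n - int k - 1) (int n - 1))\<^sup>2)"
proof (cases n)
  case 0
  then show ?thesis
    using theorem1p3_n_eq_0[of m] by simp
next
  case (Suc N)
  have L: "binom (int n + int k - 2) (int k - 1) * binom (int n - 1) (int k - 1)
      * binom (int m + int n) (int m - int k)
      = real (((N + (k - 1)) choose (k - 1)) * (N choose (k - 1))
          * ((m + N + 1) choose (N + 2 + (k - 1))))" if k: "k \<in> {1..m}" for k
  proof -
    have "int n + int k - 2 = int (N + (k - 1))" "int k - 1 = int (k - 1)" "int n - 1 = int N"
      "int m + int n = int (m + N + 1)" "int m - int k = int (m - k)"
      using k Suc by auto
    \<comment> \<open>Reflection frees the lower entry from \<open>m\<close>; it is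
      \<open>N + 1 + k\<close>, and \<open>k \<ge> 1\<close> allows the shift to
      \<open>k - 1\<close>.\<close>
    moreover have "(m + N + 1) choose (m - k) = (m + N + 1) choose (N + 2 + (k - 1))"
      using k binomial_symmetric[of "m - k" "m + N + 1"] by simp
    ultimately show ?thesis
      by (simp only: binom_of_nat of_nat_mult)
  qed
  have R: "real k * (binom (int m + int n - int k - 1) (int n - 1))\<^sup>2
      = real (k * ((m - k + N) choose N)\<^sup>2)" if k: "k \<in> {0..m}" for k
  proof -
    have "int m + int n - int k - 1 = int (m - k + N)" "int n - 1 = int N"
      using k Suc by auto
    then show ?thesis
      by (simp only: binom_of_nat of_nat_mult of_nat_power)
  qed
  define t where "t j = ((N + j) choose j) * (N choose j) * ((m + N + 1) choose (N + 2 + j))" for j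
  have "(\<Sum>k=1..m. t (k - 1)) = (\<Sum>j<m. t j)"
    by (rule sum.reindex_bij_witness[of _ Suc "\<lambda>k. k - 1"]) auto
  \<comment> \<open>Both ranges extend to a common one: \<open>t j\<close> vanishes for
    \<open>j \<ge> m\<close> by its last factor and for \<open>j > N\<close> by
    \<open>N choose j\<close>.\<close>
  also have "\<dots> = (\<Sum>j<max m (Suc N). t j)"
    by (intro sum.mono_neutral_left) (auto simp: t_def binomial_eq_0)
  also have "\<dots> = (\<Sum>j\<le>N. t j)"
    by (intro sum.mono_neutral_right) (auto simp: t_def binomial_eq_0)
  also have "\<dots> = (\<Sum>k=0..m. k * ((m - k + N) choose N)\<^sup>2)"
    unfolding t_def sum_choose_eq_convolution by (simp add: atMost_atLeast0)
  finally have "(\<Sum>k=1..m. real (t (k - 1))) = (\<Sum>k=0..m. real (k * ((m - k + N) choose N)\<^sup>2))"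
    by (simp only: of_nat_sum[symmetric])
  then show ?thesis
    unfolding t_def by (simp only: L R cong: sum.cong)
qed

end
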